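(* Let $A$ be a non-split, non-Lie, non-nilpotent, solvable (left) Leibniz algebra over $\mathbb{C}$ of dimension $3$ with $\dim(A^2)=2$. Then $A$ is spanned by some $\{x,y,z\}$ (a basis) with the nonzero products of basis vectors given by one of the following: (1) $[x,x]=z,\ [x,z]=y,\ [x,y]=y$. (2) $[x,z]=\alpha z,\ [x,y]=y$, for some $\alpha\in\mathbb{C}\setminus\{0\}$. (3) $[x,z]=y,\ [x,y]=-\frac14 z+y$. (4) $[x,x]=z,\ [x,y]=y=-[y,x]$. (5) $[x,z]=\alpha z,\ [x,y]=y=-[y,x]$, for some $\alpha\in\mathbb{C}\setminus\{0\}$. (6) $[x,x]=z,\ [x,y]=y=-[y,x],\ [x,z]=2z,\ [y,y]=z$.
   Context: All algebras are over $\mathbb{C}$. A (left) Leibniz algebra is a $\mathbb{C}$-vector space $A$ with a bilinear product $[\,,\,]:A\times A\to A$ such that $[a,[b,c]]=[[a,b],c]+[b,[a,c]]$ for all $a,b,c\in A$. $A$ is a Lie algebra iff $Leib(A)=\mathrm{span}\{[a,a]\mid a\in A\}$ is zero; non-Lie means $Leib(A)\neq 0$. Put $A^1=A=A^{(1)}$, $A^i=[A,A^{i-1}]$, $A^{(i)}=[A^{(i-1)},A^{(i-1)}]$ (spans of products) for $i\ge 2$; $A$ is nilpotent (resp. solvable) if $A^m=0$ (resp. $A^{(m)}=0$) for some positive integer $m$. $A$ is split if it is a direct sum of two nontrivial (nonzero) ideals (two-sided), and non-split otherwise. Products of basis vectors not listed are zero. *)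

theory Defs
  imports Complex_Main
begin

text \<open>
  The algebra is the whole type \<open>'a\<close>; it carries a complex vector space structure \<open>scale\<close> and the
  Leibniz product \<open>br\<close>.  \<open>Vector_Spaces.linear\<close> is linearity with respect to explicit scalar
  multiplications.
\<close>

locale leibniz_algebra = vector_space scale
  for scale :: "complex \<Rightarrow> 'a::ab_group_add \<Rightarrow> 'a" +
  fixes br :: "'a \<Rightarrow> 'a \<Rightarrow> 'a"
  assumes linear_right: "Vector_Spaces.linear scale scale (\<lambda>b. br a b)"
    and linear_left: "Vector_Spaces.linear scale scale (\<lambda>a. br a b)"
    and left_leibniz: "br a (br b c) = br (br a b) c + br b (br a c)"
begin

definition leib :: "'a set" where
  "leib = span {br a a | a. True}"

definition is_lie :: bool where
  "is_lie \<longleftrightarrow> leib = {0}"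

definition prod_span :: "'a set \<Rightarrow> 'a set \<Rightarrow> 'a set" where
  "prod_span S T = span {br s t | s t. s \<in> S \<and> t \<in> T}"

text \<open>
  Both series are indexed from 1, so that the terms of index 1 are the whole algebra; the
  value at index 0 is a dummy.
\<close>

fun lower_central :: "nat \<Rightarrow> 'a set" where
  "lower_central 0 = UNIV"
| "lower_central (Suc 0) = UNIV"
| "lower_central (Suc (Suc n)) = prod_span UNIV (lower_central (Suc n))"

fun derived :: "nat \<Rightarrow> 'a set" where
  "derived 0 = UNIV"
| "derived (Suc 0) = UNIV"
| "derived (Suc (Suc n)) = prod_span (derived (Suc n)) (derived (Suc n))"

definition is_nilpotent :: bool where
  "is_nilpotent \<longleftrightarrow> (\<exists>m\<ge>1. lower_central m = {0})"

definition is_solvable :: bool where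
  "is_solvable \<longleftrightarrow> (\<exists>m\<ge>1. derived m = {0})"

definition is_ideal :: "'a set \<Rightarrow> bool" where
  "is_ideal I \<longleftrightarrow> subspace I \<and> (\<forall>a. \<forall>i\<in>I. br a i \<in> I \<and> br i a \<in> I)"

definition is_split :: bool where
  "is_split \<longleftrightarrow> (\<exists>I J. is_ideal I \<and> is_ideal J \<and> I \<noteq> {0} \<and> J \<noteq> {0} \<and>
     I \<inter> J = {0} \<and> {u + v | u v. u \<in> I \<and> v \<in> J} = UNIV)"

definition is_basis :: "'a list \<Rightarrow> bool" where
  "is_basis bs \<longleftrightarrow> distinct bs \<and> independent (set bs) \<and> span (set bs) = UNIV"

end

text \<open>
  The full multiplication table: row \<open>i\<close>, column \<open>j\<close> holds the product of the \<open>i\<close>-th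
  with the \<open>j\<close>-th element of \<open>bs\<close>, in this order.
\<close>

definition mult_table :: "('a \<Rightarrow> 'a \<Rightarrow> 'a) \<Rightarrow> 'a list \<Rightarrow> 'a list list" where
  "mult_table br bs = map (\<lambda>a. map (\<lambda>b. br a b) bs) bs"

end

theory Submission
  imports Defs
begin

text \<open>
  Write \<open>A = \<complex>x + N\<close> with \<open>N = [A,A]\<close>.  Suppose first that \<open>N\<close> is abelian, and let \<open>T\<close> and \<open>S\<close> be left and
  right multiplication by \<open>x\<close> on \<open>N\<close>.  The Leibniz identity says exactly that \<open>T S = S T\<close>,
  \<open>(S + T) S = 0\<close> and \<open>S [x,x] = 0\<close>, and \<open>T\<close> is not nilpotent since \<open>A\<close> is not.  If \<open>T\<close> is not
  diagonalizable, then it is invertible, and \<open>S\<close> is \<open>0\<close> or \<open>-T\<close>; the latter makes \<open>A\<close> a Lie algebra and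
  the former gives (3).  Otherwise \<open>T\<close> and \<open>S\<close> are simultaneously diagonalizable, each eigenvalue of
  \<open>S\<close> being \<open>0\<close> or the negative of that of \<open>T\<close>, and adjusting \<open>x\<close> by an element of \<open>N\<close> gives (1), (2),
  (4) or (5), or a Lie algebra when \<open>S = -T\<close> is invertible.

  If \<open>N\<close> is not abelian, then solvability forces \<open>N = span {a, [a,a]}\<close> with all other products in \<open>N\<close>
  zero, because \<open>[N,N]\<close> is a line on which \<open>A\<close> acts by scalars and \<open>[A,A]\<close> acts by \<open>0\<close>.
  Left multiplication by \<open>x\<close> is a derivation, so it has eigenvalues \<open>\<nu>\<close> and \<open>2\<nu>\<close> on \<open>N\<close> with \<open>\<nu> \<noteq> 0\<close>; the
  remaining products are forced and give (6).
\<close>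

context leibniz_algebra
begin

section \<open>Bilinearity and first consequences of the Leibniz identity\<close>

lemma br_add_right: "br a (b + c) = br a b + br a c"
  and br_scale_right: "br a (scale k b) = scale k (br a b)"
  and br_add_left: "br (b + c) a = br b a + br c a"
  and br_scale_left: "br (scale k b) a = scale k (br b a)"
proof -
  interpret r: Vector_Spaces.linear scale scale "\<lambda>b. br a b" by (rule linear_right)
  interpret l: Vector_Spaces.linear scale scale "\<lambda>b. br b a" by (rule linear_left)
  show "br a (b + c) = br a b + br a c" "br a (scale k b) = scale k (br a b)"
    "br (b + c) a = br b a + br c a" "br (scale k b) a = scale k (br b a)"
    by (rule r.add r.scale l.add l.scale)+
qed

lemma br_zero_right: "br a 0 = 0" using br_scale_right[of a 0 0] by simp
lemma br_zero_left: "br 0 a = 0" using br_scale_left[of 0 0 a] by simp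
lemma br_minus_right: "br a (- b) = - br a b" using br_scale_right[of a "-1" b] by simp
lemma br_minus_left: "br (- b) a = - br b a" using br_scale_left[of "-1" b a] by simp
lemma br_diff_right: "br a (b - c) = br a b - br a c"
  using br_add_right[of a b "- c"] by (simp add: br_minus_right)
lemma br_diff_left: "br (b - c) a = br b a - br c a"
  using br_add_left[of b "- c" a] by (simp add: br_minus_left)

lemmas br_simps = br_add_right br_scale_right br_add_left br_scale_left br_zero_left br_zero_right
  br_minus_right br_minus_left br_diff_right br_diff_left

abbreviation "sq \<equiv> prod_span UNIV UNIV"

lemma br_in_prod_span: "s \<in> S \<Longrightarrow> t \<in> T \<Longrightarrow> br s t \<in> prod_span S T"
  unfolding prod_span_def by (rule span_base) blast

lemma br_in_sq: "br u v \<in> sq"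
  by (simp add: br_in_prod_span)

lemma br_br_self: "br (br u u) v = 0"
  using left_leibniz[of u u v] by simp

text \<open>Sum of the Leibniz identities for \<open>u, v\<close> and for \<open>v, u\<close>, whose
  iterated products cancel.\<close>

lemma br_sym_left: "br (br u v + br v u) w = 0"
  using left_leibniz[of u v w] left_leibniz[of v u w] by (simp add: br_simps)

lemma subspace_prod_span: "subspace (prod_span S T)"
  by (simp add: prod_span_def)

lemmas subspace_sq = subspace_prod_span[of UNIV UNIV]

section \<open>Bases adapted to the derived algebra\<close>

definition frame where
  "frame x y z \<longleftrightarrow> is_basis [x, y, z] \<and> span {y, z} = sq"

lemma frame_exists:
  assumes "dim UNIV = 3" "dim sq = 2"
  shows "\<exists>x y z. frame x y z"
proof -
  obtain B where B: "B \<subseteq> sq" "independent B" "sq \<subseteq> span B" "card B = dim sq"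
    by (rule basis_exists)
  obtain C where C': "B \<subseteq> C" "independent C" "UNIV \<subseteq> span C"
    by (rule maximal_independent_subset_extend[OF subset_UNIV B(2)])
  then have C: "B \<subseteq> C" "independent C" "span C = UNIV" by auto
  have cC: "card C = 3" using C assms(1) dim_eq_card[of C UNIV] by simp
  obtain y z where yz: "B = {y, z}" "y \<noteq> z" using B(4) assms(2) by (auto simp: card_2_iff)
  have "card (C - B) = 1" using cC B(4) C(1) assms(2) by (simp add: card_Diff_subset yz(1))
  then obtain x where x: "C - B = {x}" by (auto simp: card_1_singleton_iff)
  have Cx: "C = {x, y, z}" "x \<noteq> y" "x \<noteq> z" using x C(1) yz by auto
  have "span {y, z} = sq"
    using B(1,3) span_minimal[OF B(1)] subspace_sq yz by blast
  then show ?thesis using C Cx yz unfolding frame_def is_basis_def by auto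
qed

lemma frame_coords:
  assumes "frame x y z" "v \<in> sq"
  obtains a b where "v = scale a y + scale b z"
proof -
  have "v \<in> span {y, z}" using assms by (simp add: frame_def)
  then obtain a b where "v - scale a y - scale b z = 0"
    by (subst (asm) span_breakdown_eq, subst (asm) span_breakdown_eq) auto
  then show ?thesis by (intro that[of a b]) (simp only: diff_eq_eq add_0 add.commute)
qed

lemma frame_decomp:
  assumes "frame x y z"
  obtains k n where "n \<in> sq" "v = scale k x + n"
proof -
  have "v \<in> span {x, y, z}" using assms by (simp add: frame_def is_basis_def)
  then obtain k where "v - scale k x \<in> span {y, z}"
    by (subst (asm) span_breakdown_eq) blast
  then show ?thesis using assms by (intro that[of "v - scale k x" k]) (auto simp: frame_def)
qed

lemma frame_zero_iff:
  assumes "frame x y z"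
  shows "scale a y + scale b z = 0 \<longleftrightarrow> a = 0 \<and> b = 0"
proof -
  have ind: "independent {y, z}" and ne: "y \<noteq> z"
    using assms independent_mono[of "{x,y,z}" "{y,z}"] by (auto simp: frame_def is_basis_def)
  have z: "z \<noteq> 0" and y: "y \<notin> span {z}"
    using ind ne by (auto simp: independent_insert)
  show ?thesis
  proof
    assume h: "scale a y + scale b z = 0"
    have "a = 0"
    proof (rule ccontr)
      assume "a \<noteq> 0"
      have "scale (1/a) (scale a y + scale b z) = 0" using h by simp
      then have "y = scale (- (b/a)) z" using \<open>a \<noteq> 0\<close>
        by (simp add: scale_right_distrib eq_neg_iff_add_eq_0)
      then show False using y span_scale[OF span_base[of z "{z}"], of "- (b/a)"] by simp
    qed
    then show "a = 0 \<and> b = 0" using h z by simp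
  qed simp
qed

lemma frame_eq_iff:
  assumes "frame x y z"
  shows "scale a y + scale b z = scale c y + scale d z \<longleftrightarrow> a = c \<and> b = d"
proof -
  have "scale (a - c) y + scale (b - d) z
      = (scale a y + scale b z) - (scale c y + scale d z)"
    by (simp add: scale_left_diff_distrib)
  then show ?thesis
    using frame_zero_iff[OF assms, of "a - c" "b - d"] by simp
qed

lemma frame_nonzero:
  assumes "frame x y z" shows "y \<noteq> 0" "z \<noteq> 0"
  using frame_zero_iff[OF assms, of 1 0] frame_zero_iff[OF assms, of 0 1] by auto

lemma frame_in_sq:
  assumes "frame x y z" shows "y \<in> sq" "z \<in> sq"
  using assms span_base[of _ "{y,z}"] by (auto simp: frame_def)

text \<open>A dimension count: two independent vectors of the plane \<open>sq\<close> span it, and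
  \<open>k \<noteq> 0\<close> keeps the new first vector outside it.\<close>

lemma frame_change:
  assumes F: "frame x y z" and "y' \<in> sq" "z' \<in> sq" "y' \<noteq> 0" "\<And>c. z' \<noteq> scale c y'"
    and "k \<noteq> 0" "n \<in> sq"
  shows "frame (scale k x + n) y' z'"
proof -
  let ?x = "scale k x + n"
  have b: "x \<noteq> y" "x \<noteq> z" "y \<noteq> z" "independent {x,y,z}" "span {x,y,z} = UNIV" "span {y,z} = sq"
    using F by (auto simp: frame_def is_basis_def)
  interpret fd: finite_dimensional_vector_space scale "{x,y,z}"
    by unfold_locales (use b in auto)
  have "independent {y,z}" using b independent_mono[of "{x,y,z}" "{y,z}"] by auto
  then have d2: "dim sq = 2" using b dim_span_eq_card_independent[of "{y,z}"] by simp
  have d3: "dim UNIV = 3" using b dim_eq_card[of "{x,y,z}" UNIV] by simp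
  have ind: "independent {z', y'}"
    using assms by (subst independent_insert) (auto simp: span_singleton)
  have ne: "y' \<noteq> z'" using assms(5)[of 1] by auto
  have "sq \<subseteq> span {z',y'}"
    by (rule fd.card_ge_dim_independent) (use assms ind ne d2 in auto)
  moreover have "span {z',y'} \<subseteq> sq"
    by (rule span_minimal) (use assms subspace_sq in auto)
  ultimately have s: "span {y',z'} = sq" by (simp add: insert_commute)
  have xn: "x \<notin> sq"
    using b(1,2,4) independent_insert[of x "{y,z}"] unfolding b(6)[symmetric] by simp
  have "?x \<notin> sq"
  proof
    assume "?x \<in> sq"
    then have "?x - n \<in> sq" using assms(7) subspace_sq by (intro subspace_diff)
    then have "scale k x \<in> sq" by simp
    then have "scale (1/k) (scale k x) \<in> sq" by (rule subspace_scale[OF subspace_sq])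
    then show False using xn \<open>k \<noteq> 0\<close> by simp
  qed
  then have nin: "?x \<notin> span {y',z'}" using s by simp
  then have ne': "?x \<noteq> y'" "?x \<noteq> z'" using span_base[of _ "{y',z'}"] by fastforce+
  have ind3: "independent {?x,y',z'}" using ind nin ne'
    by (subst independent_insert) (auto simp: insert_commute)
  have "UNIV \<subseteq> span {?x,y',z'}"
    by (rule fd.card_ge_dim_independent) (use ind3 ne ne' d3 in auto)
  then show ?thesis using ind3 ne ne' s by (auto simp: frame_def is_basis_def)
qed

section \<open>Witnesses for non-nilpotent and non-Lie\<close>

lemma prod_span_subset_span:
  assumes "\<And>s t. s \<in> S \<Longrightarrow> t \<in> T \<Longrightarrow> br s t \<in> span B" shows "prod_span S T \<subseteq> span B"
  unfolding prod_span_def by (rule span_minimal) (use assms in auto)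

text \<open>Otherwise the lower central series vanishes at index 4: \<open>sq\<close> has index 2,
  and each further left factor raises the index by one.\<close>

lemma not_nilpotent_witness:
  assumes "\<not> is_nilpotent"
  obtains (witness) u v n where "n \<in> sq" "br u (br v n) \<noteq> 0"
proof (rule ccontr)
  assume "\<not> thesis"
  then have h: "br u (br v n) = 0" if "n \<in> sq" for u v n using that \<open>\<not> thesis\<close> witness by blast
  have sub: "subspace {w. \<forall>u. br u w = 0}"
    by (auto simp: subspace_def br_simps)
  have "prod_span UNIV sq \<subseteq> {w. \<forall>u. br u w = 0}"
    unfolding prod_span_def[of UNIV sq] by (rule span_minimal) (use h sub in auto)
  then have "prod_span UNIV (prod_span UNIV sq) \<subseteq> span {}"
    by (intro prod_span_subset_span) auto
  then have "prod_span UNIV (prod_span UNIV sq) = {0}"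
    using span_zero by (auto simp: prod_span_def)
  then have "lower_central 4 = {0}" by (simp add: numeral_eq_Suc)
  then show False using assms unfolding is_nilpotent_def by (meson one_le_numeral)
qed

lemma not_lie_witness:
  assumes "\<not> is_lie"
  obtains u where "br u u \<noteq> 0"
proof (rule ccontr)
  assume "\<not> thesis"
  then have "br u u = 0" for u using that by blast
  then have "{br a a | a. True} = {0}" by auto
  then have "leib = {0}" unfolding leib_def by simp
  then show False using assms by (simp add: is_lie_def)
qed

section \<open>Coordinates in a frame\<close>

definition comb where
  "comb x y z k a b = scale k x + scale a y + scale b z"

lemma comb_add: "comb x y z k a b + comb x y z k' a' b' = comb x y z (k + k') (a + a') (b + b')"
  by (simp add: comb_def scale_left_distrib)

lemma comb_scale: "scale c (comb x y z k a b) = comb x y z (c * k) (c * a) (c * b)"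
  by (simp add: comb_def scale_right_distrib)

lemma comb_minus: "- comb x y z k a b = comb x y z (- k) (- a) (- b)"
  using comb_scale[of "-1"] by simp

lemma comb_zero: "comb x y z 0 0 0 = 0"
  and comb_1: "comb x y z 1 0 0 = x"
  and comb_2: "comb x y z 0 1 0 = y"
  and comb_3: "comb x y z 0 0 1 = z"
  by (simp_all add: comb_def)

lemma comb_eq_iff:
  assumes F: "frame x y z"
  shows "comb x y z k a b = comb x y z k' a' b' \<longleftrightarrow> k = k' \<and> a = a' \<and> b = b'"
proof
  assume h: "comb x y z k a b = comb x y z k' a' b'"
  have x: "x \<notin> span {y, z}"
    using F independent_insert[of x "{y, z}"] by (auto simp: frame_def is_basis_def)
  have *: "scale (k - k') x = scale (a' - a) y + scale (b' - b) z"
    using h by (simp add: comb_def scale_left_diff_distrib algebra_simps)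
  have "scale (k - k') x \<in> span {y, z}"
    unfolding * by (intro span_add span_scale span_base) auto
  then have "scale (1 / (k - k')) (scale (k - k') x) \<in> span {y, z}"
    by (rule span_scale)
  then have k: "k = k'" using x by (cases "k = k'") auto
  then show "k = k' \<and> a = a' \<and> b = b'"
    using h frame_eq_iff[OF F, of a b a' b'] by (simp add: comb_def add.assoc)
qed simp

lemma comb_eq_0_iff:
  assumes F: "frame x y z"
  shows "comb x y z k a b = 0 \<longleftrightarrow> k = 0 \<and> a = 0 \<and> b = 0"
  using comb_eq_iff[OF F, of k a b 0 0 0] by (simp add: comb_zero)

lemma sq_comb:
  assumes "frame x y z" "v \<in> sq"
  obtains a b where "v = comb x y z 0 a b"
  using frame_coords[OF assms] by (metis comb_def add_0 scale_zero_left)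

lemma comb_in_sq:
  assumes "frame x y z" shows "comb x y z 0 a b \<in> sq"
  using frame_in_sq[OF assms] subspace_sq unfolding comb_def
  by (auto intro: subspace_add subspace_scale)

lemma comb_cases:
  assumes F: "frame x y z"
  obtains k a b where "v = comb x y z k a b"
proof -
  obtain k n where kn: "n \<in> sq" "v = scale k x + n" by (rule frame_decomp[OF F])
  obtain a b where "n = comb x y z 0 a b" by (rule sq_comb[OF F kn(1)])
  then show ?thesis using kn by (intro that[of k a b]) (simp add: comb_def add.assoc)
qed

lemma frame_change_comb:
  assumes F: "frame x y z" and k: "k \<noteq> 0" and det: "a * d \<noteq> b * c"
  shows "frame (comb x y z k l m) (comb x y z 0 a b) (comb x y z 0 c d)"
proof -
  have eq: "comb x y z k l m = scale k x + comb x y z 0 l m"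
    by (simp add: comb_def add.assoc)
  show ?thesis unfolding eq
  proof (rule frame_change[OF F _ _ _ _ k])
    show "comb x y z 0 a b \<noteq> 0" using det by (auto simp: comb_eq_0_iff[OF F])
    show "comb x y z 0 c d \<noteq> scale r (comb x y z 0 a b)" for r
      using det by (auto simp: comb_scale comb_eq_iff[OF F])
  qed (rule comb_in_sq[OF F])+
qed

section \<open>Multiplication tables for an abelian derived algebra\<close>

text \<open>
  When \<open>sq\<close> is abelian, the product is determined by \<open>[x,x] = p y + q z\<close> and by the matrices,
  given column by column, of left multiplication by \<open>x\<close> on \<open>sq\<close>, namely \<open>(a, b), (c, d)\<close>, and of right
  multiplication by \<open>x\<close> on \<open>sq\<close>, namely \<open>(e, f), (g, h)\<close>.
\<close>

definition abelian_table where
  "abelian_table x y z p q a b c d e f g h \<longleftrightarrow> frame x y z \<and>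
    br x x = comb x y z 0 p q \<and> br x y = comb x y z 0 a b \<and> br x z = comb x y z 0 c d \<and>
    br y x = comb x y z 0 e f \<and> br z x = comb x y z 0 g h \<and>
    br y y = 0 \<and> br y z = 0 \<and> br z y = 0 \<and> br z z = 0"

lemma abelian_table_frame: "abelian_table x y z p q a b c d e f g h \<Longrightarrow> frame x y z"
  by (simp add: abelian_table_def)

lemma abelian_table_exists:
  assumes F: "frame x y z" and ab: "\<And>u v. u \<in> sq \<Longrightarrow> v \<in> sq \<Longrightarrow> br u v = 0"
  obtains p q a b c d e f g h where "abelian_table x y z p q a b c d e f g h"
proof -
  obtain p q where 1: "br x x = comb x y z 0 p q" by (rule sq_comb[OF F br_in_sq])
  obtain a b where 2: "br x y = comb x y z 0 a b" by (rule sq_comb[OF F br_in_sq])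
  obtain c d where 3: "br x z = comb x y z 0 c d" by (rule sq_comb[OF F br_in_sq])
  obtain e f where 4: "br y x = comb x y z 0 e f" by (rule sq_comb[OF F br_in_sq])
  obtain g h where 5: "br z x = comb x y z 0 g h" by (rule sq_comb[OF F br_in_sq])
  show ?thesis
    by (rule that[of p q a b c d e f g h]) (simp add: abelian_table_def F 1 2 3 4 5 ab frame_in_sq[OF F])
qed

lemma abelian_table_br:
  assumes A: "abelian_table x y z p q a b c d e f g h"
  shows "br (comb x y z k l m) (comb x y z k' l' m') =
    comb x y z 0 (k*k'*p + k*l'*a + k*m'*c + l*k'*e + m*k'*g)
                 (k*k'*q + k*l'*b + k*m'*d + l*k'*f + m*k'*h)"
proof -
  have "br (comb x y z k l m) (comb x y z k' l' m') =
      scale (k*k') (br x x) + scale (k*l') (br x y) + scale (k*m') (br x z)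
      + scale (l*k') (br y x) + scale (m*k') (br z x)"
    using A by (simp add: abelian_table_def comb_def[of x y z k l m] comb_def[of x y z k' l' m']
        br_simps scale_right_distrib ac_simps)
  then show ?thesis using A by (simp add: abelian_table_def comb_add comb_scale)
qed

text \<open>Reads off matrix columns after a change to a basis of eigenvectors.\<close>

lemma abelian_table_eigen:
  assumes A: "abelian_table x y z p q a b c d e f g h"
  shows "br x y = scale k y \<Longrightarrow> a = k \<and> b = 0" "br x z = scale k z \<Longrightarrow> c = 0 \<and> d = k"
    "br y x = scale k y \<Longrightarrow> e = k \<and> f = 0" "br z x = scale k z \<Longrightarrow> g = 0 \<and> h = k"
proof -
  have y: "scale k y = comb x y z 0 k 0" and z: "scale k z = comb x y z 0 0 k"
    by (simp_all add: comb_def)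
  show "br x y = scale k y \<Longrightarrow> a = k \<and> b = 0" "br x z = scale k z \<Longrightarrow> c = 0 \<and> d = k"
    "br y x = scale k y \<Longrightarrow> e = k \<and> f = 0" "br z x = scale k z \<Longrightarrow> g = 0 \<and> h = k"
    using A unfolding y z by (auto simp: abelian_table_def comb_eq_iff[OF abelian_table_frame[OF A]])
qed

text \<open>
  With \<open>T\<close> and \<open>S\<close> the matrices of left and right multiplication by \<open>x\<close>, these are the entries of
  \<open>T S = S T\<close>, \<open>(S + T) S = 0\<close> and \<open>S [x,x] = 0\<close>.
\<close>

lemma abelian_table_leibniz:
  assumes A: "abelian_table x y z p q a b c d e f g h"
  shows "c*f = g*b" "b*e + d*f = f*a + h*b" "a*g + c*h = e*c + g*d"
    "e*e + g*f + (a*e + c*f) = 0" "f*e + h*f + (b*e + d*f) = 0"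
    "e*g + g*h + (a*g + c*h) = 0" "f*g + h*h + (b*g + d*h) = 0"
    "e*p + g*q = 0" "f*p + h*q = 0"
proof -
  note F = abelian_table_frame[OF A]
  note S = abelian_table_br[OF A] comb_add comb_eq_iff[OF F]
  note L = left_leibniz[of "comb x y z k l m" "comb x y z k' l' m'" "comb x y z k'' l'' m''" for k l m k' l' m' k'' l'' m'']
  from L[of 1 0 0 0 1 0 1 0 0] show "c*f = g*b" "b*e + d*f = f*a + h*b" by (auto simp: S algebra_simps)
  from L[of 1 0 0 0 0 1 1 0 0] show "a*g + c*h = e*c + g*d" by (auto simp: S algebra_simps)
  from L[of 0 1 0 1 0 0 1 0 0] show "e*e + g*f + (a*e + c*f) = 0" "f*e + h*f + (b*e + d*f) = 0"
    by (auto simp: S algebra_simps)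
  from L[of 0 0 1 1 0 0 1 0 0] show "e*g + g*h + (a*g + c*h) = 0" "f*g + h*h + (b*g + d*h) = 0"
    by (auto simp: S algebra_simps)
  from L[of 1 0 0 1 0 0 1 0 0] show "e*p + g*q = 0" "f*p + h*q = 0"
    by (auto simp: S algebra_simps)
qed

text \<open>Since \<open>S = -T\<close>, the mixed terms of \<open>br u u\<close> cancel and only a
  multiple of \<open>br x x\<close> remains.\<close>

lemma abelian_table_not_lie:
  assumes A: "abelian_table x y z p q a b c d (-a) (-b) (-c) (-d)" and "\<not> is_lie"
  shows "p \<noteq> 0 \<or> q \<noteq> 0"
proof -
  obtain u where u: "br u u \<noteq> 0" using not_lie_witness[OF assms(2)] by blast
  obtain k l m where "u = comb x y z k l m" by (rule comb_cases[OF abelian_table_frame[OF A]])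
  then show ?thesis using u
    by (auto simp: abelian_table_br[OF A] comb_eq_0_iff[OF abelian_table_frame[OF A]])
qed

text \<open>Only \<open>br x x\<close> can leave the line of \<open>y\<close>; if it did not,
  \<open>sq\<close> would be at most a line.\<close>

lemma abelian_table_second_coord:
  assumes A: "abelian_table x y z p q a 0 c 0 e 0 g 0"
  shows "q \<noteq> 0"
proof
  assume "q = 0"
  have y: "comb x y z 0 r 0 \<in> span {y}" for r
    by (simp add: comb_def span_scale span_base)
  have "br u v \<in> span {y}" for u v
  proof -
    obtain k l m where "u = comb x y z k l m" by (rule comb_cases[OF abelian_table_frame[OF A]])
    moreover obtain k' l' m' where "v = comb x y z k' l' m'" by (rule comb_cases[OF abelian_table_frame[OF A]])
    ultimately show ?thesis using \<open>q = 0\<close>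
      by (simp add: abelian_table_br[OF A] y)
  qed
  then have "sq \<subseteq> span {y}" by (intro prod_span_subset_span)
  then have "z \<in> span {y}" using frame_in_sq(2)[OF abelian_table_frame[OF A]] by auto
  then obtain k where "z = scale k y" by (auto simp: span_singleton)
  then show False using comb_eq_iff[OF abelian_table_frame[OF A], of 0 0 1 0 k 0] by (simp add: comb_def)
qed

text \<open>The four entries are those of \<open>T^2\<close>, and two successive left
  multiplications act on \<open>sq\<close> as a multiple of \<open>T^2\<close>.\<close>

lemma abelian_table_not_nilpotent:
  assumes A: "abelian_table x y z p q a b c d e f g h" and "\<not> is_nilpotent"
  shows "\<not> (a*a + c*b = 0 \<and> b*a + d*b = 0 \<and> a*c + c*d = 0 \<and> b*c + d*d = 0)"
proof
  note F = abelian_table_frame[OF A]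
  assume T: "a*a + c*b = 0 \<and> b*a + d*b = 0 \<and> a*c + c*d = 0 \<and> b*c + d*d = 0"
  obtain u v n where w: "n \<in> sq" "br u (br v n) \<noteq> 0"
    by (rule not_nilpotent_witness[OF assms(2)])
  obtain l m where n: "n = comb x y z 0 l m" by (rule sq_comb[OF F w(1)])
  obtain k1 l1 m1 where u: "u = comb x y z k1 l1 m1" by (rule comb_cases[OF F])
  obtain k2 l2 m2 where v: "v = comb x y z k2 l2 m2" by (rule comb_cases[OF F])
  have "br u (br v n) = comb x y z 0 (k1*k2*(l*(a*a + c*b) + m*(a*c+c*d))) (k1*k2*(l*(b*a+d*b) + m*(b*c+d*d)))"
    by (simp add: u v n abelian_table_br[OF A] comb_eq_iff[OF F] algebra_simps)
  then show False using w T by (simp add: comb_zero)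
qed

section \<open>Normal forms for an abelian derived algebra\<close>

definition normal_form where
  "normal_form x y z \<longleftrightarrow> is_basis [x, y, z] \<and>
    (mult_table br [x, y, z] = [[z, y, y], [0, 0, 0], [0, 0, 0]]
     \<or> (\<exists>\<alpha>. \<alpha> \<noteq> 0 \<and> mult_table br [x, y, z] = [[0, y, scale \<alpha> z], [0, 0, 0], [0, 0, 0]])
     \<or> mult_table br [x, y, z] = [[0, scale (- 1 / 4) z + y, y], [0, 0, 0], [0, 0, 0]]
     \<or> mult_table br [x, y, z] = [[z, y, 0], [- y, 0, 0], [0, 0, 0]]
     \<or> (\<exists>\<alpha>. \<alpha> \<noteq> 0 \<and> mult_table br [x, y, z] = [[0, y, scale \<alpha> z], [- y, 0, 0], [0, 0, 0]])
     \<or> mult_table br [x, y, z] = [[z, y, scale 2 z], [- y, z, 0], [0, 0, 0]])"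

lemma normal_form_5:
  assumes A: "abelian_table x y z 0 q a 0 0 d (-a) 0 0 0" and "a \<noteq> 0" "d \<noteq> 0"
  shows "\<exists>x y z. normal_form x y z"
proof -
  note F = abelian_table_frame[OF A]
  \<comment> \<open>Dividing by \<open>a\<close> makes the eigenvalue of \<open>y\<close> equal to
    1; the \<open>z\<close>-shift cancels \<open>br x x\<close>, as
    \<open>d \<noteq> 0\<close>.\<close>
  let ?x = "comb x y z (1/a) 0 (- q/(a*d))" and ?y = "comb x y z 0 1 0" and ?z = "comb x y z 0 0 1"
  have "frame ?x ?y ?z" by (rule frame_change_comb[OF F]) (use assms in auto)
  moreover have "mult_table br [?x, ?y, ?z] = [[0, ?y, scale (d/a) ?z], [- ?y, 0, 0], [0, 0, 0]]"
    using assms(2,3) by (simp add: mult_table_def abelian_table_br[OF A] comb_scale comb_minus comb_eq_0_iff[OF F] comb_eq_iff[OF F])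
  ultimately have "normal_form ?x ?y ?z" using assms(2,3)
    unfolding normal_form_def frame_def by (meson divide_eq_0_iff)
  then show ?thesis by blast
qed

text \<open>The Leibniz identity leaves two choices for each of \<open>e\<close> and
  \<open>h\<close>. If just one of them is nonzero the result is (5), or (4) when
  \<open>d = 0\<close>; if both vanish it is (2), or (1) when \<open>d = 0\<close>; both nonzero
  would give a Lie algebra.\<close>

lemma normal_form_diag:
  assumes A: "abelian_table x y z p q a 0 0 d e 0 0 h" and a: "a \<noteq> 0" and nl: "\<not> is_lie"
  shows "\<exists>x y z. normal_form x y z"
proof -
  note F = abelian_table_frame[OF A]
  note S = mult_table_def abelian_table_br[OF A] comb_scale comb_minus comb_eq_0_iff[OF F] comb_eq_iff[OF F]
  have "e * (e + a) = 0" "h * (h + d) = 0" "e * p = 0" "h * q = 0"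
    using abelian_table_leibniz[OF A] by (auto simp: algebra_simps)
  then have eh: "e = 0 \<or> e = - a \<and> p = 0" "h = 0 \<or> h = - d \<and> q = 0"
    using a by (auto simp: eq_neg_iff_add_eq_0)
  show ?thesis
  proof (cases "e = 0")
    case e: False
    then have e': "e = - a" "p = 0" using eh by auto
    \<comment> \<open>Otherwise \<open>S = -T\<close> and \<open>br x x = 0\<close>, contradicting
      non-Lie.\<close>
    have h: "h = 0"
      using abelian_table_not_lie[of x y z p q a 0 0 d] A e' eh nl by auto
    show ?thesis
    proof (cases "d = 0")
      case False
      then show ?thesis using normal_form_5[of x y z q a d] A a e' h by simp
    next
      case d: True
      have q: "q \<noteq> 0" using abelian_table_second_coord[of x y z p q a 0 e 0] A d h by simp
      \<comment> \<open>As \<open>d = 0\<close>, no shift removes \<open>br x x\<close>; its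
        rescaled value becomes the new \<open>z\<close>.\<close>
      let ?x = "comb x y z (1/a) 0 0" and ?y = "comb x y z 0 1 0" and ?z = "comb x y z 0 0 (q/(a*a))"
      have "frame ?x ?y ?z" by (rule frame_change_comb[OF F]) (use a q in auto)
      moreover have "mult_table br [?x, ?y, ?z] = [[?z, ?y, 0], [- ?y, 0, 0], [0, 0, 0]]"
        using a e' d h by (simp add: S)
      ultimately have "normal_form ?x ?y ?z"
        unfolding normal_form_def frame_def by blast
      then show ?thesis by blast
    qed
  next
    case e: True
    show ?thesis
    proof (cases "h = 0")
      case False
      then have h: "h = - d" "q = 0" "d \<noteq> 0" using eh by auto
      \<comment> \<open>Here \<open>S\<close> is nonzero on \<open>z\<close> instead of
        \<open>y\<close>, so the two are interchanged.\<close>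
      have "frame (comb x y z 1 0 0) (comb x y z 0 0 1) (comb x y z 0 1 0)"
        by (rule frame_change_comb[OF F]) auto
      then have F': "frame x z y" by (simp add: comb_1 comb_2 comb_3)
      have "abelian_table x z y 0 p d 0 0 a (-d) 0 0 0"
        using A F' e h unfolding abelian_table_def by (simp add: comb_def)
      then show ?thesis using a h by (intro normal_form_5)
    next
      case h: True
      show ?thesis
      proof (cases "d = 0")
        case False
        \<comment> \<open>With \<open>S = 0\<close> and \<open>T\<close> invertible, shifting
          \<open>x\<close> by minus the inverse image of \<open>br x x\<close> under
          \<open>T\<close> cancels the square.\<close>
        let ?x = "comb x y z (1/a) (-p/(a*a)) (-q/(a*d))" and ?y = "comb x y z 0 1 0" and ?z = "comb x y z 0 0 1"
        have "frame ?x ?y ?z" by (rule frame_change_comb[OF F]) (use a in auto)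
        moreover have "mult_table br [?x, ?y, ?z] = [[0, ?y, scale (d/a) ?z], [0, 0, 0], [0, 0, 0]]"
          using a e h False by (simp add: S)
        ultimately have "normal_form ?x ?y ?z" using a False
          unfolding normal_form_def frame_def by (meson divide_eq_0_iff)
        then show ?thesis by blast
      next
        case d: True
        have q: "q \<noteq> 0" using abelian_table_second_coord[of x y z p q a 0 e 0] A d h by simp
        \<comment> \<open>The shift gives the square of the new \<open>x\<close> the
          \<open>y\<close>-coordinate 1, so that left multiplication sends this square, the new
          \<open>z\<close>, to \<open>y\<close>.\<close>
        let ?x = "comb x y z (1/a) (1 - p/(a*a)) 0" and ?y = "comb x y z 0 1 0" and ?z = "comb x y z 0 1 (q/(a*a))"
        have "frame ?x ?y ?z" by (rule frame_change_comb[OF F]) (use a q in auto)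
        moreover have "mult_table br [?x, ?y, ?z] = [[?z, ?y, ?y], [0, 0, 0], [0, 0, 0]]"
          using a e d h by (simp add: S field_simps)
        ultimately have "normal_form ?x ?y ?z"
          unfolding normal_form_def frame_def by blast
        then show ?thesis by blast
      qed
    qed
  qed
qed

text \<open>Commuting with a Jordan block forces \<open>f = 0\<close> and \<open>h = e\<close>; then
  \<open>(S + T) S = 0\<close> leaves \<open>S = 0\<close> or \<open>S = -T\<close>.\<close>

lemma normal_form_jordan:
  assumes A: "abelian_table x y z p q a 0 c a e f g h" and "a \<noteq> 0" "c \<noteq> 0" and nl: "\<not> is_lie"
  shows "\<exists>x y z. normal_form x y z"
proof -
  note F = abelian_table_frame[OF A]
  note L = abelian_table_leibniz[OF A]
  note S = mult_table_def abelian_table_br[OF A] comb_scale comb_add comb_minus comb_eq_0_iff[OF F] comb_eq_iff[OF F]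
  have f: "f = 0" using L(1) assms by simp
  have h: "h = e" using L(3) assms by (simp add: algebra_simps)
  have "e * (e + a) = 0" using L(4) f by (simp add: algebra_simps)
  then consider "e = 0" | "e = - a" by (auto simp: eq_neg_iff_add_eq_0)
  then show ?thesis
  proof cases
    case 1
    have g: "g = 0" using L(6) 1 h assms by simp
    \<comment> \<open>In (3) left multiplication by \<open>x\<close> has the double eigenvalue 1/2,
      hence the factor \<open>1/(2*a)\<close>. The vector \<open>z\<close> is cyclic,
      \<open>?y\<close> is its image, and Cayley-Hamilton gives the product with \<open>?y\<close>.
      The shift cancels the square of \<open>x\<close>.\<close>
    let ?x = "comb x y z (1/(2*a)) (-(p - c*q/a)/(2*a*a)) (-q/(2*a*a))"
      and ?y = "comb x y z 0 (c/(2*a)) (1/2)" and ?z = "comb x y z 0 0 1"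
    have "frame ?x ?y ?z" by (rule frame_change_comb[OF F]) (use assms in auto)
    moreover have "mult_table br [?x, ?y, ?z] = [[0, scale (- 1 / 4) ?z + ?y, ?y], [0, 0, 0], [0, 0, 0]]"
      using assms(2) 1 f g h by (simp add: S field_simps)
    ultimately have "normal_form ?x ?y ?z"
      unfolding normal_form_def frame_def by blast
    then show ?thesis by blast
  next
    case 2
    have "- (a * c) = a * g" using L(6) 2 h by (simp add: algebra_simps)
    then have "a * (c + g) = 0" by (metis add.right_inverse distrib_left)
    then have g: "g = - c" using assms by (simp add: eq_neg_iff_add_eq_0 add.commute)
    \<comment> \<open>Now \<open>S = -T\<close> is invertible, so \<open>S [x,x] = 0\<close> kills
      \<open>br x x\<close> and the algebra would be Lie.\<close>
    have "q = 0" using L(9) f h 2 assms by simp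
    moreover have "p = 0" using L(8) calculation 2 assms by simp
    ultimately show ?thesis using abelian_table_not_lie[of x y z p q a 0 c a] A 2 f g h nl by simp
  qed
qed

text \<open>If both eigenvalues were 0, trace and determinant would vanish and Cayley-Hamilton would
  make the square of the matrix zero.\<close>

lemma eigenvector_2x2:
  fixes a b c d :: complex
  assumes "\<not> (a*a + c*b = 0 \<and> b*a + d*b = 0 \<and> a*c + c*d = 0 \<and> b*c + d*d = 0)"
  obtains k l m where "k \<noteq> 0" "l \<noteq> 0 \<or> m \<noteq> 0" "l*a + m*c = k*l" "l*b + m*d = k*m"
proof -
  define s where "s = csqrt ((a+d)^2 - 4*(a*d - b*c))"
  have s: "s*s = (a+d)^2 - 4*(a*d - b*c)" unfolding s_def by (metis power2_csqrt power2_eq_square)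
  have ex: "\<exists>k. k \<noteq> 0 \<and> k*k - (a+d)*k + (a*d - b*c) = 0"
  proof (rule ccontr)
    assume none: "\<not> ?thesis"
    have root: "((a+d+r)/2)*((a+d+r)/2) - (a+d)*((a+d+r)/2) + (a*d - b*c)
        = (r*r - ((a+d)^2 - 4*(a*d - b*c))) / 4" for r
      by (simp add: field_simps power2_eq_square)
    have "((a+d+s)/2)*((a+d+s)/2) - (a+d)*((a+d+s)/2) + (a*d - b*c) = 0"
      "((a+d-s)/2)*((a+d-s)/2) - (a+d)*((a+d-s)/2) + (a*d - b*c) = 0"
      using s root[of s] root[of "-s"] by simp_all
    then have "(a+d+s)/2 = 0" "(a+d-s)/2 = 0" using none by blast+
    then have pm: "a+d+s = 0" "a+d-s = 0" by auto
    have "2*s = (a+d+s) - (a+d-s)" by simp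
    then have s0: "s = 0" using pm by simp
    then have t: "d = - a" using pm(1) by (simp add: eq_neg_iff_add_eq_0 add.commute)
    have "4 * (a*a + c*b) = 0" using s unfolding s0 t by (simp add: algebra_simps)
    then have "a*a + c*b = 0" unfolding mult_eq_0_iff by simp
    then show False using assms t by (simp add: algebra_simps)
  qed
  then obtain k where k: "k \<noteq> 0" "k*k - (a+d)*k + (a*d - b*c) = 0" by blast
  \<comment> \<open>A nonzero off-diagonal entry yields an eigenvector for \<open>k\<close>; a
    diagonal matrix has a basis vector as eigenvector, with a diagonal entry in place of
    \<open>k\<close>.\<close>
  consider "c \<noteq> 0" | "b \<noteq> 0" | "b = 0" "c = 0" "a \<noteq> 0" | "b = 0" "c = 0" "d \<noteq> 0"
    using assms by (cases "a = 0"; cases "b = 0"; cases "c = 0"; cases "d = 0") auto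
  then show ?thesis
  proof cases
    case 1
    then show ?thesis using k by (intro that[of k c "k - a"]) (auto simp: algebra_simps)
  next
    case 2
    then show ?thesis using k by (intro that[of k "k - d" b]) (auto simp: algebra_simps)
  next
    case 3
    then show ?thesis by (intro that[of a 1 0]) auto
  next
    case 4
    then show ?thesis by (intro that[of d 0 1]) auto
  qed
qed

text \<open>An eigenvector with nonzero eigenvalue as \<open>y\<close> makes \<open>T\<close>
  triangular. Then \<open>T\<close> has distinct eigenvalues, or is a Jordan block, or is scalar, in
  which case \<open>S\<close> can be diagonalized freely.\<close>

lemma normal_form_abelian:
  assumes F: "frame x y z" and ab: "\<And>u v. u \<in> sq \<Longrightarrow> v \<in> sq \<Longrightarrow> br u v = 0"
    and nl: "\<not> is_lie" and nn: "\<not> is_nilpotent"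
  shows "\<exists>x y z. normal_form x y z"
proof -
  obtain y1 z1 k where F1: "frame x y1 z1" and k: "k \<noteq> 0" and xy1: "br x y1 = scale k y1"
  proof -
    obtain p q a b c d e f g h where A: "abelian_table x y z p q a b c d e f g h"
      using abelian_table_exists[OF F ab] by blast
    obtain k l m where k: "k \<noteq> 0" "l \<noteq> 0 \<or> m \<noteq> 0" "l*a + m*c = k*l" "l*b + m*d = k*m"
      using eigenvector_2x2[OF abelian_table_not_nilpotent[OF A nn]] by blast
    let ?y = "comb x y z 0 l m"
    have "br (comb x y z 1 0 0) ?y = scale k ?y"
      using k by (simp add: abelian_table_br[OF A] comb_scale)
    then have e: "br x ?y = scale k ?y" by (simp add: comb_1)
    show ?thesis
    proof (cases "l = 0")
      case True
      then have "frame (comb x y z 1 0 0) ?y (comb x y z 0 1 0)"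
        using k by (intro frame_change_comb[OF F]) auto
      then show ?thesis using that e k by (simp add: comb_1)
    next
      case False
      then have "frame (comb x y z 1 0 0) ?y (comb x y z 0 0 1)"
        using k by (intro frame_change_comb[OF F]) auto
      then show ?thesis using that e k by (simp add: comb_1)
    qed
  qed
  obtain p q a b c d e f g h where A': "abelian_table x y1 z1 p q a b c d e f g h"
    using abelian_table_exists[OF F1 ab] by blast
  then have "a = k" "b = 0"
    using xy1 abelian_table_eigen(1)[OF A'] by blast+
  with A' have A: "abelian_table x y1 z1 p q k 0 c d e f g h" by simp
  note L = abelian_table_leibniz[OF A]
  note S = abelian_table_br[OF A] comb_scale comb_eq_iff[OF F1] comb_eq_0_iff[OF F1]
  show ?thesis
  proof (cases "d = k")
    case False
    let ?z = "comb x y1 z1 0 (c/(d - k)) 1"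
    have "frame (comb x y1 z1 1 0 0) (comb x y1 z1 0 1 0) ?z"
      by (rule frame_change_comb[OF F1]) auto
    then have F2: "frame x y1 ?z" by (simp add: comb_1 comb_2)
    obtain p q a b c' d' e f g h where A2: "abelian_table x y1 ?z p q a b c' d' e f g h"
      using abelian_table_exists[OF F2 ab] by blast
    have "br (comb x y1 z1 1 0 0) ?z = scale d ?z"
      using False by (simp add: S field_simps)
    then have "br x ?z = scale d ?z" by (simp add: comb_1)
    then have T: "a = k" "b = 0" "c' = 0" "d' = d"
      using xy1 abelian_table_eigen(1,2)[OF A2] by blast+
    \<comment> \<open>\<open>S\<close> commutes with a diagonal \<open>T\<close> whose eigenvalues
      differ.\<close>
    have "f = 0" "g = 0" using abelian_table_leibniz(2,3)[OF A2] T False by (auto simp: algebra_simps)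
    then have "abelian_table x y1 ?z p q k 0 0 d e 0 0 h" using A2 T by simp
    then show ?thesis by (rule normal_form_diag[OF _ k nl])
  next
    case d: True
    show ?thesis
    proof (cases "c = 0")
      case False
      have "abelian_table x y1 z1 p q k 0 c k e f g h" using A d by simp
      then show ?thesis by (rule normal_form_jordan[OF _ k False nl])
    next
      case c: True
      show ?thesis
      proof (cases "f = 0 \<and> g = 0")
        case True
        have "abelian_table x y1 z1 p q k 0 0 k e 0 0 h" using A c d True by simp
        then show ?thesis by (rule normal_form_diag[OF _ k nl])
      next
        case False
        have eq: "e*e + g*f + k*e = 0" "f*(e + h + k) = 0" "g*(e + h + k) = 0" "f*g + h*h + k*h = 0"
          using L c d by (auto simp: algebra_simps)
        \<comment> \<open>Right multiplication \<open>S\<close> by \<open>x\<close> satisfies \<open>S\<^sup>2 = - k S\<close>, so the columns of \<open>S\<close> and of \<open>S + k\<close> are eigenvectors for \<open>- k\<close> and \<open>0\<close>.\<close>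
        obtain l m l' m' where E: "l*m' \<noteq> m*l'" "l*e + m*g = -k*l" "l*f + m*h = -k*m"
          "l'*e + m'*g = 0" "l'*f + m'*h = 0"
        proof (cases "f = 0")
          case True
          then have "g \<noteq> 0" using False by simp
          show ?thesis
          \<comment> \<open>The witnesses come in the order \<open>l\<close>, \<open>m'\<close>,
            \<open>m\<close>, \<open>l'\<close>: second columns of \<open>S\<close> and
            \<open>S + k\<close> here, first columns in the other case.\<close>
          proof (rule that[of g "h + k" h g])
            show "g*(h+k) \<noteq> h*g" using \<open>g \<noteq> 0\<close> k by (simp add: algebra_simps)
            show "g*e + h*g = -k*g" using eq(3) by algebra
            show "g*f + h*h = -k*h" using eq(4) by algebra
            show "g*e + (h+k)*g = 0" using eq(3) by algebra
            show "g*f + (h+k)*h = 0" using eq(4) by algebra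
          qed
        next
          case False
          show ?thesis
          proof (rule that[of e f f "e + k"])
            show "e*f \<noteq> f*(e+k)" using \<open>f \<noteq> 0\<close> k by (simp add: algebra_simps)
            show "e*e + f*g = -k*e" using eq(1) by algebra
            show "e*f + f*h = -k*f" using eq(2) by algebra
            show "(e+k)*e + f*g = 0" using eq(1) by algebra
            show "(e+k)*f + f*h = 0" using eq(2) by algebra
          qed
        qed
        let ?y = "comb x y1 z1 0 l m" and ?z = "comb x y1 z1 0 l' m'"
        have "frame (comb x y1 z1 1 0 0) ?y ?z" using E by (intro frame_change_comb[OF F1]) auto
        then have F2: "frame x ?y ?z" by (simp add: comb_1)
        obtain p2 q2 a2 b2 c2 d2 e2 f2 g2 h2 where A2: "abelian_table x ?y ?z p2 q2 a2 b2 c2 d2 e2 f2 g2 h2"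
          using abelian_table_exists[OF F2 ab] by blast
        have "br (comb x y1 z1 1 0 0) ?y = scale k ?y" "br (comb x y1 z1 1 0 0) ?z = scale k ?z"
          "br ?y (comb x y1 z1 1 0 0) = scale (-k) ?y" "br ?z (comb x y1 z1 1 0 0) = scale 0 ?z"
          using E by (simp_all add: S c d)
        then have "br x ?y = scale k ?y" "br x ?z = scale k ?z" "br ?y x = scale (-k) ?y" "br ?z x = scale 0 ?z"
          by (simp_all add: comb_1)
        then have "a2 = k" "b2 = 0" "c2 = 0" "d2 = k" "f2 = 0" "g2 = 0"
          using abelian_table_eigen[OF A2] by blast+
        then have "abelian_table x ?y ?z p2 q2 k 0 0 k e2 0 0 h2" using A2 by simp
        then show ?thesis by (rule normal_form_diag[OF _ k nl])
      qed
    qed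
  qed
qed

section \<open>The case of a nonabelian derived algebra\<close>

text \<open>Otherwise the derived series is constantly \<open>sq\<close>, which is nonzero, from
  index 2 on.\<close>

lemma solvable_square_proper:
  assumes F: "frame x y z" and "is_solvable"
  shows "prod_span sq sq \<noteq> sq"
proof
  assume eq: "prod_span sq sq = sq"
  have "derived (Suc (Suc n)) = sq" for n by (induction n) (simp_all add: eq)
  moreover obtain m where m: "m \<ge> 1" "derived m = {0}" using assms(2) by (auto simp: is_solvable_def)
  moreover have "derived 1 = UNIV" by simp
  ultimately have "sq = {0} \<or> UNIV = {0 :: 'a}"
    by (metis One_nat_def Suc_le_D not0_implies_Suc)
  then show False using frame_in_sq[OF F] frame_nonzero[OF F] by blast
qed

lemma nonabelian_frame:
  assumes F: "frame x y z" and solv: "is_solvable"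
    and uv: "u \<in> sq" "v \<in> sq" "br u v \<noteq> 0"
  obtains a where "frame x a (br a a)" "br a (br a a) = 0"
proof -
  let ?W = "prod_span sq sq"
  define b where "b = br u v"
  have W: "subspace ?W" by (rule subspace_prod_span)
  have bW: "b \<in> ?W" unfolding b_def using uv by (intro br_in_prod_span)
  have "?W \<subseteq> sq"
    unfolding prod_span_def[of sq sq] by (rule span_minimal[OF _ subspace_sq]) (auto simp: br_in_sq)
  then obtain a where a: "a \<in> sq" "a \<notin> ?W" using solvable_square_proper[OF F solv] by blast
  have F1: "frame x a b"
  proof -
    have "frame (scale 1 x + 0) a b"
    proof (rule frame_change[OF F])
      show "a \<in> sq" "0 \<in> sq" by (use a subspace_sq subspace_0 in auto)
      show "b \<in> sq" by (simp add: b_def br_in_sq)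
      show "a \<noteq> 0" using a W subspace_0 by auto
      show "b \<noteq> scale c a" for c
      proof
        assume c: "b = scale c a"
        then have "c \<noteq> 0" using uv b_def by auto
        then have "a = scale (1/c) b" using c by simp
        then show False using a subspace_scale[OF W bW] by simp
      qed
    qed simp
    then show ?thesis by simp
  qed
  have W_b: "\<exists>k. w = scale k b" if w: "w \<in> ?W" for w
  proof -
    obtain \<alpha> \<beta> where c: "w = scale \<alpha> a + scale \<beta> b"
      using frame_coords[OF F1] w \<open>?W \<subseteq> sq\<close> by blast
    have "\<alpha> = 0"
    proof (rule ccontr)
      assume "\<alpha> \<noteq> 0"
      have "w - scale \<beta> b \<in> ?W" using w bW W by (intro subspace_diff subspace_scale)
      then have "scale (1/\<alpha>) (w - scale \<beta> b) \<in> ?W" by (rule subspace_scale[OF W])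
      then show False using a \<open>\<alpha> \<noteq> 0\<close> by (simp add: c)
    qed
    then show ?thesis using c by auto
  qed
  \<comment> \<open>Left multiplication is a derivation, so it preserves the line
    \<open>?W\<close>.\<close>
  have wb: "\<exists>k. br w b = scale k b" for w
  proof (rule W_b)
    have "br w b = br (br w u) v + br u (br w v)"
      unfolding b_def by (rule left_leibniz)
    also have "\<dots> \<in> ?W" using uv W by (intro subspace_add br_in_prod_span br_in_sq)
    finally show "br w b \<in> ?W" .
  qed
  \<comment> \<open>The scalars by which \<open>w\<close> and \<open>w'\<close> act on
    \<open>b\<close> commute.\<close>
  have "br (br w w') b = 0" for w w'
  proof -
    obtain k k' where "br w b = scale k b" "br w' b = scale k' b" using wb by metis
    then show ?thesis using left_leibniz[of w w' b] by (simp add: br_simps mult.commute)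
  qed
  moreover have "subspace {n. br n b = 0}" by (auto simp: subspace_def br_simps)
  ultimately have "sq \<subseteq> {n. br n b = 0}"
    unfolding prod_span_def by (intro span_minimal) auto
  then have nb: "br n b = 0" if "n \<in> sq" for n using that by blast
  have bb: "br b b = 0" and ab: "br a b = 0" using nb a by (auto simp: b_def br_in_sq)
  obtain q where q: "br b a = scale q b"
    using W_b[of "br b a"] a by (auto simp: b_def br_in_sq br_in_prod_span)
  obtain p where p: "br a a = scale p b"
    using W_b[of "br a a"] a by (auto simp: br_in_prod_span)
  have b0: "b \<noteq> 0" using uv by (simp add: b_def)
  \<comment> \<open>The Leibniz identity for \<open>b, a, a\<close> reads
    \<open>q^2 b = 0\<close>.\<close>
  have "q = 0"
    using left_leibniz[of b a a] b0 by (simp add: p q br_simps bb ab)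
  have "p \<noteq> 0"
  proof
    assume "p = 0"
    obtain l m l' m' where "u = scale l a + scale m b" "v = scale l' a + scale m' b"
      using frame_coords[OF F1] uv by metis
    then have "br u v = 0" by (simp add: br_simps bb ab p q \<open>p = 0\<close> \<open>q = 0\<close>)
    then show False using uv by simp
  qed
  then have "frame (comb x a b 1 0 0) (comb x a b 0 1 0) (comb x a b 0 0 p)"
    by (intro frame_change_comb[OF F1]) auto
  then have "frame x a (br a a)" by (simp add: p comb_def)
  then show ?thesis by (rule that) (simp add: p br_simps ab)
qed

lemma normal_form_nonabelian:
  assumes F: "frame x y z" and yy: "br y y = z" and yz: "br y z = 0"
    and nn: "\<not> is_nilpotent"
  shows "\<exists>x y z. normal_form x y z"
proof -
  have z: "br z w = 0" for w using br_br_self[of y w] by (simp add: yy)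
  obtain \<nu> \<rho> where xy: "br x y = scale \<nu> y + scale \<rho> z" by (rule frame_coords[OF F br_in_sq])
  obtain s t where yx: "br y x = scale s y + scale t z" by (rule frame_coords[OF F br_in_sq])
  obtain c v where xx: "br x x = scale c y + scale v z" by (rule frame_coords[OF F br_in_sq])
  note B = br_simps yy yz z xy yx xx
  have z0: "z \<noteq> 0" by (rule frame_nonzero[OF F])
  have xz: "br x z = scale (2 * \<nu>) z"
    using left_leibniz[of x y y] by (simp add: B scale_left_distrib[symmetric])
  have \<nu>: "\<nu> \<noteq> 0"
  proof
    assume \<nu>: "\<nu> = 0"
    obtain u w n where w: "n \<in> sq" "br u (br w n) \<noteq> 0" by (rule not_nilpotent_witness[OF nn])
    obtain l m where n: "n = scale l y + scale m z" by (rule frame_coords[OF F w(1)])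
    obtain k1 l1 m1 where u: "u = comb x y z k1 l1 m1" by (rule comb_cases[OF F])
    obtain k2 l2 m2 where v: "w = comb x y z k2 l2 m2" by (rule comb_cases[OF F])
    show False using w(2) by (simp add: n u v comb_def B xz \<nu>)
  qed
  have "br (br x y + br y x) y = 0" by (rule br_sym_left)
  then have "scale (\<nu> + s) z = 0" by (simp add: B scale_left_distrib)
  then have s: "s = - \<nu>" using z0 by (simp add: eq_neg_iff_add_eq_0 add.commute)
  have "br (br x x) y = 0" by (rule br_br_self)
  then have c: "c = 0" using z0 by (simp add: B)
  have "scale (2 * \<nu> * t) z = scale (\<nu> * \<rho> + \<nu> * t) z"
    using left_leibniz[of x y x]
    by (simp add: B xz s c scale_right_distrib scale_left_diff_distrib algebra_simps
        del: scale_cancel_right)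
  then have "\<nu> * t = \<nu> * \<rho>" using z0 by simp
  then have t: "t = \<rho>" using \<nu> by simp
  have P: "br (comb x y z k l m) (comb x y z k' l' m') =
      comb x y z 0 (k*l'*\<nu> - l*k'*\<nu>) (k*k'*v + k*l'*\<rho> + 2*\<nu>*k*m' + l*k'*\<rho> + l*l')"
    for k l m k' l' m'
    by (simp add: comb_def B xz s c t scale_right_distrib scale_left_distrib
        scale_right_diff_distrib scale_left_diff_distrib algebra_simps)
  \<comment> \<open>\<open>?y\<close> is the eigenvector for \<nu>, rescaled to eigenvalue 1; the
    \<open>z\<close>-shift makes the square of \<open>?x\<close> exactly \<open>z\<close>.\<close>
  let ?x = "comb x y z (1/\<nu>) 0 ((1 - v/(\<nu>*\<nu>))/2)" and ?y = "comb x y z 0 1 (-\<rho>/\<nu>)"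
    and ?z = "comb x y z 0 0 1"
  have "frame ?x ?y ?z" by (rule frame_change_comb[OF F]) (use \<nu> in auto)
  moreover have "mult_table br [?x, ?y, ?z] = [[?z, ?y, scale 2 ?z], [- ?y, ?z, 0], [0, 0, 0]]"
    using \<nu> by (simp add: mult_table_def P comb_scale comb_minus comb_eq_0_iff[OF F] comb_eq_iff[OF F] field_simps)
  ultimately have "normal_form ?x ?y ?z"
    unfolding normal_form_def frame_def by blast
  then show ?thesis by blast
qed

section \<open>Combination of the two cases\<close>

lemma normal_form_exists:
  assumes "\<not> is_lie" "\<not> is_nilpotent" "is_solvable" "dim UNIV = 3" "dim (lower_central 2) = 2"
  shows "\<exists>x y z. normal_form x y z"
proof -
  have "lower_central 2 = sq" by (simp add: numeral_2_eq_2)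
  then obtain x y z where F: "frame x y z" using frame_exists assms(4,5) by auto
  show ?thesis
  proof (cases "\<exists>u\<in>sq. \<exists>v\<in>sq. br u v \<noteq> 0")
    case True
    then obtain a where "frame x a (br a a)" "br a (br a a) = 0"
      using nonabelian_frame[OF F assms(3)] by blast
    then show ?thesis using assms(2) by (intro normal_form_nonabelian) auto
  next
    case False
    then show ?thesis using normal_form_abelian[OF F _ assms(1,2)] by blast
  qed
qed

end

theorem theorem3p1:
  fixes scale :: "complex \<Rightarrow> 'a::ab_group_add \<Rightarrow> 'a"
    and br :: "'a \<Rightarrow> 'a \<Rightarrow> 'a"
  assumes "leibniz_algebra scale br"
    and "\<not> leibniz_algebra.is_split scale br"
    and "\<not> leibniz_algebra.is_lie scale br"
    and "\<not> leibniz_algebra.is_nilpotent scale br"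
    and "leibniz_algebra.is_solvable scale br"
    and "vector_space.dim scale (UNIV :: 'a set) = 3"
    and "vector_space.dim scale (leibniz_algebra.lower_central scale br 2) = 2"
  shows "\<exists>x y z. leibniz_algebra.is_basis scale [x, y, z] \<and>
    (mult_table br [x, y, z] =
       [[z, y, y],
        [0, 0, 0],
        [0, 0, 0]]
     \<or> (\<exists>\<alpha>. \<alpha> \<noteq> 0 \<and> mult_table br [x, y, z] =
       [[0, y, scale \<alpha> z],
        [0, 0, 0],
        [0, 0, 0]])
     \<or> mult_table br [x, y, z] =
       [[0, scale (- 1 / 4) z + y, y],
        [0, 0, 0],
        [0, 0, 0]]
     \<or> mult_table br [x, y, z] =
       [[z, y, 0],
        [- y, 0, 0],
        [0, 0, 0]]
     \<or> (\<exists>\<alpha>. \<alpha> \<noteq> 0 \<and> mult_table br [x, y, z] =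
       [[0, y, scale \<alpha> z],
        [- y, 0, 0],
        [0, 0, 0]])
     \<or> mult_table br [x, y, z] =
       [[z, y, scale 2 z],
        [- y, z, 0],
        [0, 0, 0]])"
  using leibniz_algebra.normal_form_exists[OF assms(1,3-7)]
  unfolding leibniz_algebra.normal_form_def[OF assms(1)] .

end
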